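(* Let $(w_n)_{n\in\mathbb{N}_0}$ be a sequence of vectors $w_n=(w_{n,0},w_{n,1},w_{n,2})^{\mathrm t}\in[0,\infty)^3$, put $|w_n|=w_{n,0}+w_{n,1}+w_{n,2}$ and $b_n=|w_n|(1,1,1)^{\mathrm t}-w_n$. Let $d_0\in\mathbb{R}^3$ and let $(d_n)_{n\in\mathbb{N}_0}$ be defined by $d_{n+1}=3\mathbf{I}d_n+b_n$ for all $n\in\mathbb{N}_0$, where $\mathbf{I}$ is the $3\times3$ identity matrix. Then for all $n\in\mathbb{N}_0$, $$d_n=3^nd_0+\sum_{\nu=0}^{n-1}3^{\nu}b_{n-1-\nu}.$$
   Context: $\mathbb{N}_0$ denotes the nonnegative integers; the superscript $\mathrm t$ denotes transpose; an empty sum is zero. *)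

theory Defs
  imports "HOL-Analysis.Analysis"
begin

text \<open>The index type \<^typ>\<open>3\<close> consists of the residues \<open>0, 1, 2\<close>, so the components of
  a vector are accessed directly by these indices.\<close>

definition weight :: "real ^ 3 \<Rightarrow> real"
  where "weight v = v $ 0 + v $ 1 + v $ 2"

end

theory Submission
  imports Defs
begin

text \<open>Multiplication by \<open>3\<close> times the identity matrix is scaling by \<open>3\<close>, so the claim is an
  instance of the solution of the first-order linear recurrence \<open>x (n + 1) = c x n + b n\<close> in a
  real vector space (lemma \<open>linear_recurrence_solution\<close>): each \<open>b m\<close> enters at time \<open>m + 1\<close> and
  is scaled by \<open>c\<close> in every later step, so at time \<open>n\<close> it carries the factor
  \<open>c ^ (n - 1 - m)\<close>.\<close>

text \<open>One further step multiplies all earlier contributions by \<open>c\<close>, which shifts the summation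
  index by one and leaves the term with index \<open>0\<close> for the newly added \<open>b n\<close>.\<close>

lemma linear_recurrence_solution:
  fixes x b :: "nat \<Rightarrow> 'a :: real_vector" and c :: real
  assumes rec: "\<And>n. x (Suc n) = c *\<^sub>R x n + b n"
  shows "x n = c ^ n *\<^sub>R x 0 + (\<Sum>\<nu><n. c ^ \<nu> *\<^sub>R b (n - 1 - \<nu>))"
proof (induction n)
  case 0
  show ?case by simp
next
  case (Suc n)
  have "x (Suc n) = c *\<^sub>R (c ^ n *\<^sub>R x 0 + (\<Sum>\<nu><n. c ^ \<nu> *\<^sub>R b (n - 1 - \<nu>))) + b n"
    by (subst rec, subst Suc.IH) (rule refl)
  also have "\<dots> = c ^ Suc n *\<^sub>R x 0 + (b n + (\<Sum>\<nu><n. c ^ Suc \<nu> *\<^sub>R b (n - 1 - \<nu>)))"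
    by (simp add: scaleR_right_distrib scaleR_sum_right)
  also have "b n + (\<Sum>\<nu><n. c ^ Suc \<nu> *\<^sub>R b (n - 1 - \<nu>))
      = (\<Sum>\<nu><Suc n. c ^ \<nu> *\<^sub>R b (Suc n - 1 - \<nu>))"
    by (subst sum.lessThan_Suc_shift) simp
  finally show ?case .
qed

theorem proposition2:
  fixes w b d :: "nat \<Rightarrow> real ^ 3"
  assumes w_nonneg: "\<And>n i. 0 \<le> w n $ i"
    and b_def: "\<And>n. b n = weight (w n) *\<^sub>R (\<chi> i. 1) - w n"
    and d_rec: "\<And>n. d (Suc n) = (3 *\<^sub>R mat 1) *v d n + b n"
  shows "\<forall>n. d n = 3 ^ n *\<^sub>R d 0 + (\<Sum>\<nu><n. 3 ^ \<nu> *\<^sub>R b (n - 1 - \<nu>))"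
proof
  fix n
  have "d (Suc m) = 3 *\<^sub>R d m + b m" for m
    by (simp add: d_rec flip: scaleR_matrix_vector_assoc)
  then show "d n = 3 ^ n *\<^sub>R d 0 + (\<Sum>\<nu><n. 3 ^ \<nu> *\<^sub>R b (n - 1 - \<nu>))"
    by (rule linear_recurrence_solution)
qed

end
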